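(* Let $\mathbf{L}=\langle L,\leq\rangle$ be a complete lattice, $S$ an $L$-parameterization, and $C\colon L\to L$ an $S$-closure operator in $\mathbf{L}$. Then for all $a\in L$ and all $\langle f,h\rangle\in S$: $$f(C(a))\leq C(f(a)),\qquad C(h(a))\leq h(C(a)),\qquad f(C(h(a)))\leq h(C(f(a))).$$
   Context: An isotone Galois connection in $\mathbf{L}$ is a pair $\langle f,h\rangle$ of maps $L\to L$ with $f(a)\leq b$ iff $a\leq h(b)$. An $L$-parameterization is a set $S$ of isotone Galois connections containing $\langle\mathrm{id},\mathrm{id}\rangle$. An $S$-closure operator is $C\colon L\to L$ with $a\leq C(a)$, $a\leq b$ implies $C(a)\leq C(b)$, and $C(h(C(a)))\leq h(C(a))$ for all $a,b\in L$ and $\langle f,h\rangle\in S$. *)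

theory Defs
  imports Main
begin

definition isotone_galois :: "('a::order \<Rightarrow> 'a) \<Rightarrow> ('a \<Rightarrow> 'a) \<Rightarrow> bool" where
  "isotone_galois f h \<longleftrightarrow> (\<forall>a b. f a \<le> b \<longleftrightarrow> a \<le> h b)"

definition L_parameterization :: "(('a::complete_lattice \<Rightarrow> 'a) \<times> ('a \<Rightarrow> 'a)) set \<Rightarrow> bool" where
  "L_parameterization S \<longleftrightarrow> (\<forall>(f, h) \<in> S. isotone_galois f h) \<and> (id, id) \<in> S"

definition S_closure_operator ::
    "(('a::complete_lattice \<Rightarrow> 'a) \<times> ('a \<Rightarrow> 'a)) set \<Rightarrow> ('a \<Rightarrow> 'a) \<Rightarrow> bool" where
  "S_closure_operator S C \<longleftrightarrow>
     (\<forall>a. a \<le> C a) \<and>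
     (\<forall>a b. a \<le> b \<longrightarrow> C a \<le> C b) \<and>
     (\<forall>a. \<forall>(f, h) \<in> S. C (h (C a)) \<le> h (C a))"

end

theory Submission
  imports Defs
begin

text \<open>The last closure axiom makes every \<open>h (C b)\<close> a fixed point of
  \<open>C\<close>. As \<open>h (C b)\<close> lies above \<open>h b\<close>, it must also lie above
  \<open>C (h b)\<close>, which is \<open>C_h\<close>. The inequality for \<open>f\<close> is the
  mate of \<open>C_h\<close> under the adjunction, obtained through the unit
  \<open>b \<le> h (f b)\<close>. The mixed inequality combines both with the counit
  \<open>f (h a) \<le> a\<close>.\<close>

lemma isotone_galois_unit: "isotone_galois f h \<Longrightarrow> a \<le> h (f a)"
  unfolding isotone_galois_def by blast

lemma isotone_galois_counit: "isotone_galois f h \<Longrightarrow> f (h a) \<le> a"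
  unfolding isotone_galois_def by blast

lemma isotone_galois_upper_mono: "isotone_galois f h \<Longrightarrow> a \<le> b \<Longrightarrow> h a \<le> h b"
  unfolding isotone_galois_def by (meson order_refl order_trans)

theorem theorem35:
  fixes S :: "(('a::complete_lattice \<Rightarrow> 'a) \<times> ('a \<Rightarrow> 'a)) set"
    and C :: "'a \<Rightarrow> 'a"
  assumes "L_parameterization S"
    and "S_closure_operator S C"
  shows "\<forall>a. \<forall>(f, h) \<in> S.
           f (C a) \<le> C (f a) \<and>
           C (h a) \<le> h (C a) \<and>
           f (C (h a)) \<le> h (C (f a))"
proof -
  have ext: "a \<le> C a" and mono: "a \<le> b \<Longrightarrow> C a \<le> C b" for a b
    using assms(2) unfolding S_closure_operator_def by auto
  have "f (C a) \<le> C (f a) \<and> C (h a) \<le> h (C a) \<and> f (C (h a)) \<le> h (C (f a))"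
    if fh: "(f, h) \<in> S" for a f h
  proof -
    have gal: "isotone_galois f h"
      using assms(1) fh unfolding L_parameterization_def by auto
    have C_h: "C (h b) \<le> h (C b)" for b
    proof -
      have "C (h b) \<le> C (h (C b))"
        by (intro mono isotone_galois_upper_mono[OF gal] ext)
      also have "\<dots> \<le> h (C b)"
        using assms(2) fh unfolding S_closure_operator_def by auto
      finally show ?thesis .
    qed
    \<comment> \<open>This is \<open>f_C\<close> transposed across the adjunction: apply
      \<open>C\<close> to the unit at \<open>b\<close>, then use \<open>C_h\<close> at
      \<open>f b\<close>.\<close>
    have C_h_f: "C b \<le> h (C (f b))" for b
      using mono[OF isotone_galois_unit[OF gal]] C_h by (rule order_trans)
    then have f_C: "f (C b) \<le> C (f b)" for b
      using gal unfolding isotone_galois_def by blast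
    \<comment> \<open>The two sides are separated by \<open>C a\<close>: the counit bounds the left
      side by it, and \<open>C_h_f\<close> puts it below the right side.\<close>
    have "f (C (h a)) \<le> C (f (h a))" by (rule f_C)
    also have "\<dots> \<le> C a" by (intro mono isotone_galois_counit[OF gal])
    also have "\<dots> \<le> h (C (f a))" by (rule C_h_f)
    finally show ?thesis using f_C C_h by blast
  qed
  then show ?thesis by blast
qed

end
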